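(* For every integer $m\geq 3$, there exists a set of $m$ points in $\mathbb{R}^{m-1}$ that is in crescent configuration.
   Context: A set of points in $\mathbb{R}^d$ is in general position if no $d+1$ of the points lie on a common (affine) hyperplane of $\mathbb{R}^d$ and no $d+2$ of the points lie on a common hypersphere of $\mathbb{R}^d$. A set of $n$ points in $\mathbb{R}^d$ is in crescent configuration if the points are in general position in $\mathbb{R}^d$, the Euclidean distances between the $\binom{n}{2}$ pairs of distinct points take exactly $n-1$ distinct values, and for every $1\le i\le n-1$ there is one of these distance values that is attained by exactly $i$ pairs of points. *)

theory Defs
  imports "HOL-Analysis.Analysis"
begin

definition on_common_hyperplane :: "'a::euclidean_space set \<Rightarrow> bool" where
  "on_common_hyperplane S \<longleftrightarrow> (\<exists>a b. a \<noteq> 0 \<and> S \<subseteq> {x. a \<bullet> x = b})"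

definition on_common_hypersphere :: "'a::euclidean_space set \<Rightarrow> bool" where
  "on_common_hypersphere S \<longleftrightarrow> (\<exists>c r. r > 0 \<and> S \<subseteq> sphere c r)"

definition general_position :: "'a::euclidean_space set \<Rightarrow> bool" where
  "general_position P \<longleftrightarrow>
     (\<forall>S\<subseteq>P. card S = DIM('a) + 1 \<longrightarrow> \<not> on_common_hyperplane S) \<and>
     (\<forall>S\<subseteq>P. card S = DIM('a) + 2 \<longrightarrow> \<not> on_common_hypersphere S)"

definition distances :: "'a::euclidean_space set \<Rightarrow> real set" where
  "distances P = {dist p q | p q. p \<in> P \<and> q \<in> P \<and> p \<noteq> q}"

definition pairs_at_distance :: "'a::euclidean_space set \<Rightarrow> real \<Rightarrow> 'a set set" where
  "pairs_at_distance P t = {{p, q} | p q. p \<in> P \<and> q \<in> P \<and> p \<noteq> q \<and> dist p q = t}"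

definition crescent_configuration :: "'a::euclidean_space set \<Rightarrow> bool" where
  "crescent_configuration P \<longleftrightarrow>
     finite P \<and> general_position P \<and>
     card (distances P) = card P - 1 \<and>
     (\<forall>i. 1 \<le> i \<and> i \<le> card P - 1 \<longrightarrow>
        (\<exists>t\<in>distances P. card (pairs_at_distance P t) = i))"

end

theory Submission
  imports Defs
begin

text \<open>Fix an orthonormal basis \<open>e 1, \<dots>, e d\<close> and put \<open>p 0 = 0\<close> and
  \<open>p j = e 1 + \<dots> + e (j - 1) + (1 + \<surd>j) e j\<close>.  For \<open>i < j\<close> a direct computation
  gives \<open>\<parallel>p i - p j\<parallel>\<^sup>2 = 2 j + 2 \<surd>j\<close>, so the distance of two of these points depends
  only on the larger index and strictly increases with it.  Hence there are exactly \<open>d\<close>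
  distances, the \<open>j\<close>-th of them attained by the \<open>j\<close> pairs \<open>{p i, p j}\<close> with \<open>i < j\<close>.
  The coordinate matrix of \<open>p 1, \<dots>, p d\<close> is triangular with nonzero diagonal and
  \<open>p 0 = 0\<close>, so the \<open>d + 1\<close> points lie on no common hyperplane; having only \<open>d + 1\<close>
  points, they are trivially not \<open>d + 2\<close> points on a common sphere.\<close>

definition crescent_coord :: "nat \<Rightarrow> nat \<Rightarrow> real" where
  "crescent_coord j k = (if k < j then 1 else if k = j then 1 + sqrt (real k) else 0)"

lemma sum_sq_crescent_coord_diff_upto:
  assumes "m < j" "i < j"
  shows "(\<Sum>k=1..m. (crescent_coord i k - crescent_coord j k)\<^sup>2) = (if m < i then 0 else real m)"
  using assms
proof (induction m)
  case 0
  then show ?case by simp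
next
  case (Suc m)
  then have "(\<Sum>k=1..Suc m. (crescent_coord i k - crescent_coord j k)\<^sup>2)
      = (if m < i then 0 else real m) + (crescent_coord i (Suc m) - crescent_coord j (Suc m))\<^sup>2"
    by simp
  moreover consider "Suc m < i" | "Suc m = i" | "i < Suc m" by linarith
  ultimately show ?case
    using Suc.prems by cases (simp_all add: crescent_coord_def)
qed

lemma sum_sq_crescent_coord_diff:
  assumes "i < j" "j \<le> n"
  shows "(\<Sum>k=1..n. (crescent_coord i k - crescent_coord j k)\<^sup>2) = 2 * real j + 2 * sqrt (real j)"
  using assms
proof (induction n)
  case 0
  then show ?case by simp
next
  case (Suc n)
  show ?case
  proof (cases "j = Suc n")
    case True
    have "(\<Sum>k=1..n. (crescent_coord i k - crescent_coord j k)\<^sup>2) = real n"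
      using sum_sq_crescent_coord_diff_upto[of n j i] Suc.prems True by simp
    moreover have "(crescent_coord i j - crescent_coord j j)\<^sup>2 = 1 + 2 * sqrt (real j) + real j"
      using Suc.prems by (simp add: crescent_coord_def power2_eq_square algebra_simps)
    ultimately show ?thesis using True by simp
  next
    case False
    then show ?thesis using Suc by (simp add: crescent_coord_def)
  qed
qed

lemma inner_sum_orthonormal:
  assumes "inj_on e A" "e ` A \<subseteq> Basis"
  shows "(\<Sum>k\<in>A. x k *\<^sub>R e k) \<bullet> (\<Sum>k\<in>A. y k *\<^sub>R e k) = (\<Sum>k\<in>A. x k * y k)"
proof -
  have "finite A"
    using assms finite_Basis finite_imageD finite_subset by metis
  have orth: "e l \<bullet> e k = (if l = k then 1 else 0)" if "k \<in> A" "l \<in> A" for k l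
    using assms that by (auto simp: inj_on_eq_iff image_subset_iff intro!: inner_not_same_Basis)
  have "(\<Sum>l\<in>A. x l * (e l \<bullet> e k)) = (\<Sum>l\<in>A. if l = k then x k else 0)" if "k \<in> A" for k
    using that by (intro sum.cong) (simp_all add: orth)
  then show ?thesis using \<open>finite A\<close>
    by (simp add: inner_sum_left inner_sum_right sum_distrib_left mult.commute cong: sum.cong)
qed

definition crescent_point :: "(nat \<Rightarrow> 'a::real_vector) \<Rightarrow> nat \<Rightarrow> nat \<Rightarrow> 'a" where
  "crescent_point e d j = (\<Sum>k=1..d. crescent_coord j k *\<^sub>R e k)"

lemma dist_crescent_point:
  assumes "inj_on e {1..d}" "e ` {1..d} \<subseteq> Basis" "i < j" "j \<le> d"
  shows "dist (crescent_point e d i) (crescent_point e d j) = sqrt (2 * real j + 2 * sqrt (real j))"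
proof -
  let ?x = "\<lambda>k. crescent_coord i k - crescent_coord j k"
  have "crescent_point e d i - crescent_point e d j = (\<Sum>k=1..d. ?x k *\<^sub>R e k)"
    by (simp add: crescent_point_def scaleR_diff_left sum_subtractf)
  then have "dist (crescent_point e d i) (crescent_point e d j) = sqrt (\<Sum>k=1..d. ?x k * ?x k)"
    using assms(1,2) by (simp add: dist_norm norm_eq_sqrt_inner inner_sum_orthonormal)
  also have "(\<Sum>k=1..d. ?x k * ?x k) = 2 * real j + 2 * sqrt (real j)"
    using sum_sq_crescent_coord_diff[OF assms(3,4)] by (simp add: power2_eq_square)
  finally show ?thesis .
qed

lemma crescent_point_not_on_common_hyperplane:
  assumes e: "bij_betw e {1..d} Basis"
  shows "\<not> on_common_hyperplane (crescent_point e d ` {0..d})"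
proof
  assume "on_common_hyperplane (crescent_point e d ` {0..d})"
  then obtain c b where "c \<noteq> 0" and on_plane: "\<And>j. j \<le> d \<Longrightarrow> c \<bullet> crescent_point e d j = b"
    unfolding on_common_hyperplane_def by (auto simp: image_subset_iff)
  have inner: "c \<bullet> crescent_point e d j = (\<Sum>k=1..d. crescent_coord j k * (c \<bullet> e k))" for j
    by (simp add: crescent_point_def inner_sum_right)
  have "b = 0"
    using on_plane[of 0] inner[of 0] by (simp add: crescent_coord_def)
  have "\<forall>k. 1 \<le> k \<and> k \<le> m \<longrightarrow> c \<bullet> e k = 0" if "m \<le> d" for m
    using that
  proof (induction m)
    case 0
    then show ?case by simp
  next
    case (Suc m)
    then have IH: "\<And>k. 1 \<le> k \<Longrightarrow> k \<le> m \<Longrightarrow> c \<bullet> e k = 0" by auto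
    have "c \<bullet> crescent_point e d (Suc m)
        = (\<Sum>k=1..d. if k = Suc m then crescent_coord (Suc m) (Suc m) * (c \<bullet> e (Suc m)) else 0)"
      unfolding inner by (rule sum.cong) (auto simp: crescent_coord_def IH)
    also have "\<dots> = crescent_coord (Suc m) (Suc m) * (c \<bullet> e (Suc m))"
      using Suc.prems by simp
    finally have "crescent_coord (Suc m) (Suc m) * (c \<bullet> e (Suc m)) = 0"
      using on_plane[OF Suc.prems] \<open>b = 0\<close> by simp
    moreover have "crescent_coord (Suc m) (Suc m) > 0"
      by (simp add: crescent_coord_def add_pos_nonneg)
    ultimately show ?case using IH by (auto simp: le_Suc_eq)
  qed
  then have "\<forall>k\<in>{1..d}. c \<bullet> e k = 0"
    by auto
  moreover have "Basis = e ` {1..d}"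
    using e by (simp add: bij_betw_def)
  ultimately have "\<forall>u\<in>Basis. c \<bullet> u = 0"
    by (metis imageE)
  then show False
    using \<open>c \<noteq> 0\<close> euclidean_all_zero_iff by blast
qed

lemma general_position_if_not_on_common_hyperplane:
  fixes P :: "'a::euclidean_space set"
  assumes P: "finite P" "card P = DIM('a) + 1" and "\<not> on_common_hyperplane P"
  shows "general_position P"
  unfolding general_position_def
proof (intro conjI allI impI)
  fix S
  assume "S \<subseteq> P" "card S = DIM('a) + 1"
  then have "S = P"
    using P card_subset_eq by metis
  then show "\<not> on_common_hyperplane S"
    using assms(3) by simp
next
  fix S
  assume "S \<subseteq> P" "card S = DIM('a) + 2"
  then show "\<not> on_common_hypersphere S"
    using P card_mono[of P S] by simp
qed

context
  fixes p :: "nat \<Rightarrow> 'a::euclidean_space" and a :: "nat \<Rightarrow> real" and d :: nat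
  assumes dist_eq_last: "\<And>i j. i < j \<Longrightarrow> j \<le> d \<Longrightarrow> dist (p i) (p j) = a j"
    and last_pos: "\<And>j. j \<in> {1..d} \<Longrightarrow> 0 < a j"
    and inj_last: "inj_on a {1..d}"
begin

lemma dist_points_eq_max:
  assumes "i \<le> d" "j \<le> d" "i \<noteq> j"
  shows "dist (p i) (p j) = a (max i j)"
  using assms dist_eq_last[of i j] dist_eq_last[of j i] by (auto simp: max_def dist_commute)

lemma inj_on_points: "inj_on p {0..d}"
proof (rule inj_onI)
  fix i j
  assume ij: "i \<in> {0..d}" "j \<in> {0..d}" "p i = p j"
  show "i = j"
  proof (rule ccontr)
    assume "i \<noteq> j"
    then have "0 < a (max i j)"
      using ij by (intro last_pos) (auto simp: max_def)
    then show False
      using dist_points_eq_max[of i j] ij \<open>i \<noteq> j\<close> by simp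
  qed
qed

lemma points_eq_iff: "i \<le> d \<Longrightarrow> j \<le> d \<Longrightarrow> p i = p j \<longleftrightarrow> i = j"
  using inj_on_points by (auto dest: inj_onD)

lemma card_points: "card (p ` {0..d}) = d + 1"
  using card_image[OF inj_on_points] by simp

lemma distances_points: "distances (p ` {0..d}) = a ` {1..d}"
proof (intro equalityI subsetI)
  fix t
  assume "t \<in> distances (p ` {0..d})"
  then obtain i j where ij: "i \<le> d" "j \<le> d" "p i \<noteq> p j" "t = dist (p i) (p j)"
    unfolding distances_def by auto
  then have "i \<noteq> j"
    by auto
  then have "max i j \<in> {1..d}"
    using ij by (auto simp: max_def)
  then show "t \<in> a ` {1..d}"
    using ij \<open>i \<noteq> j\<close> dist_points_eq_max[of i j] by auto
next
  fix t
  assume "t \<in> a ` {1..d}"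
  then obtain j where j: "j \<in> {1..d}" "t = dist (p 0) (p j)"
    using dist_eq_last by auto
  then show "t \<in> distances (p ` {0..d})"
    unfolding distances_def mem_Collect_eq
    using points_eq_iff[of 0 j] by (intro exI[of _ "p 0"] exI[of _ "p j"] conjI) auto
qed

lemma pairs_at_distance_points:
  assumes j: "j \<in> {1..d}"
  shows "pairs_at_distance (p ` {0..d}) (a j) = (\<lambda>i. {p i, p j}) ` {0..<j}"
proof (intro equalityI subsetI)
  fix s
  assume "s \<in> pairs_at_distance (p ` {0..d}) (a j)"
  then obtain i k where ik: "i \<le> d" "k \<le> d" "p i \<noteq> p k" "dist (p i) (p k) = a j" "s = {p i, p k}"
    unfolding pairs_at_distance_def by auto
  then have "i \<noteq> k"
    by auto
  then have "a (max i k) = a j" "max i k \<in> {1..d}"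
    using ik dist_points_eq_max by (auto simp: max_def)
  then have "max i k = j"
    using j inj_last by (auto dest: inj_onD)
  then show "s \<in> (\<lambda>i. {p i, p j}) ` {0..<j}"
    using ik \<open>i \<noteq> k\<close> by (cases "i < k") (auto simp: max_def insert_commute)
next
  fix s
  assume "s \<in> (\<lambda>i. {p i, p j}) ` {0..<j}"
  then obtain i where i: "i < j" "s = {p i, p j}"
    by auto
  moreover have "p i \<noteq> p j" "dist (p i) (p j) = a j"
    using i j points_eq_iff[of i j] dist_eq_last[of i j] by auto
  moreover have "p i \<in> p ` {0..d}" "p j \<in> p ` {0..d}"
    using i j by auto
  ultimately show "s \<in> pairs_at_distance (p ` {0..d}) (a j)"
    unfolding pairs_at_distance_def by blast
qed

lemma card_pairs_at_distance_points:
  assumes j: "j \<in> {1..d}"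
  shows "card (pairs_at_distance (p ` {0..d}) (a j)) = j"
proof -
  have "inj_on (\<lambda>i. {p i, p j}) {0..<j}"
    using j by (intro inj_onI) (auto simp: doubleton_eq_iff points_eq_iff)
  then show ?thesis
    by (simp add: pairs_at_distance_points[OF j] card_image)
qed

lemma crescent_configuration_points:
  assumes "general_position (p ` {0..d})"
  shows "crescent_configuration (p ` {0..d})"
  unfolding crescent_configuration_def
proof (intro conjI allI impI)
  show "card (distances (p ` {0..d})) = card (p ` {0..d}) - 1"
    using card_image[OF inj_last] by (simp add: distances_points card_points)
next
  fix i
  assume "1 \<le> i \<and> i \<le> card (p ` {0..d}) - 1"
  then have "i \<in> {1..d}"
    by (simp add: card_points)
  then show "\<exists>t\<in>distances (p ` {0..d}). card (pairs_at_distance (p ` {0..d}) t) = i"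
    using card_pairs_at_distance_points by (auto simp: distances_points)
qed (use assms in simp_all)

end

theorem crescent_configuration_exists:
  "\<exists>P :: 'a::euclidean_space set. card P = DIM('a) + 1 \<and> crescent_configuration P"
proof -
  obtain e :: "nat \<Rightarrow> 'a" where e: "bij_betw e {1..DIM('a)} Basis"
    using finite_same_card_bij[of "{1..DIM('a)}" Basis] by auto
  define p where "p = crescent_point e DIM('a)"
  define a where "a j = sqrt (2 * real j + 2 * sqrt (real j))" for j :: nat
  have dist: "dist (p i) (p j) = a j" if "i < j" "j \<le> DIM('a)" for i j
    unfolding p_def a_def using e that by (intro dist_crescent_point) (auto simp: bij_betw_def)
  have pos: "0 < a j" if "j \<in> {1..DIM('a)}" for j
    using that by (simp add: a_def add_pos_nonneg)
  have "strict_mono a"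
    by (rule strict_monoI) (simp add: a_def add_strict_mono)
  then have inj: "inj_on a {1..DIM('a)}"
    using strict_mono_imp_inj_on inj_on_subset by blast
  have "general_position (p ` {0..DIM('a)})"
    using crescent_point_not_on_common_hyperplane[OF e] card_points[OF dist pos inj]
    unfolding p_def by (intro general_position_if_not_on_common_hyperplane) auto
  then show ?thesis
    using card_points[OF dist pos inj] crescent_configuration_points[OF dist pos inj] by blast
qed

theorem mainTheorem2:
  assumes "CARD('n::finite) \<ge> 2"
  shows "\<exists>P :: (real ^ 'n) set. card P = CARD('n) + 1 \<and> crescent_configuration P"
  using crescent_configuration_exists[where 'a = "real ^ 'n"] by simp

end
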